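(* Let $A=((a_n,r_n))_{n\ge0}$ be an annular Swiss cheese with $\delta_{\rm ann}(A)>0$, such that $\mu(A)<\infty$ and $(r_n)_{n=2}^\infty$ is non-increasing. Let $\mathcal A$ be the family of all $B=((b_n,s_n))\in\mathcal F$ such that (a) the sequence $(s_n)_{n\ge2}$ is non-increasing, (b) $\rho_{\rm ann}(B)\le\rho_{\rm ann}(A)$, (c) $\mu(B)\le\mu(A)$, (d) $B$ is partially above $A$, and (e) $b_0=b_1=a_0$ and $r_0\ge s_0\ge s_1\ge r_1$. Then there exists a classical, annular Swiss cheese $B=((b_n,s_n))\in\mathcal A$ such that $\delta_{\rm ann}(B)\ge\delta_{\rm ann}(A)$ and $X_B\subseteq X_A$. Moreover, $r_0-2\rho_{\rm ann}(A)\le s_0\le r_0$ and $r_1\le s_1\le r_1+2\rho_{\rm ann}(A)$.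
   Context: Notation: $\mathbb R^+=[0,\infty)$, $\mathbb N=\{1,2,\dots\}$, $\mathbb N_0=\{0,1,2,\dots\}$. For $a\in\mathbb C$, $r>0$, $B(a,r)$ and $\bar B(a,r)$ are the open and closed disks of centre $a$ and radius $r$; $B(a,0)=\emptyset$ and $\bar B(a,0)=\{a\}$. Abstract Swiss cheese space is $\mathcal F=(\mathbb C\times\mathbb R^+)^{\mathbb N_0}$ with the product topology; its elements $A=((a_n,r_n))_{n\ge0}$ are abstract Swiss cheeses. Put $S_A=\{n\in\mathbb N:r_n>0\}$, $X_A=\bar B(a_0,r_0)\setminus\bigcup_{n=1}^\infty B(a_n,r_n)$, $\mu(A)=\sup_{n\in\mathbb N}|a_n|$, $\rho_{\rm ann}(A)=\sum_{n=2}^\infty r_n$ and $\delta_{\rm ann}(A)=r_0-r_1-2\rho_{\rm ann}(A)$. $A$ is annular (an annular Swiss cheese) if $a_0=a_1$ and $0<r_1<r_0$. $A$ is classical if $\sum_{n\ge1}r_n<\infty$, $r_0>0$, and for all $k\in S_A$: $\bar B(a_k,r_k)\subseteq B(a_0,r_0)$, and $\bar B(a_k,r_k)\cap\bar B(a_\ell,r_\ell)=\emptyset$ for all $\ell\in S_A$ with $\ell\ne k$. $B=((b_n,s_n))$ is partially above $A=((a_n,r_n))$ if $\bar B(b_0,s_0)\subseteq\bar B(a_0,r_0)$ and, for each $n\in\mathbb N$, either $B(a_n,r_n)\subseteq\mathbb C\setminus\bar B(b_0,s_0)$, or there exists $m\in\mathbb N$ with $B(a_n,r_n)\subseteq B(b_m,s_m)$,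 or both. *)

theory Defs
  imports "HOL-Analysis.Analysis"
begin

type_synonym discs = "nat \<Rightarrow> complex \<times> real"

abbreviation centre :: "discs \<Rightarrow> nat \<Rightarrow> complex" where
  "centre A n \<equiv> fst (A n)"

abbreviation radius :: "discs \<Rightarrow> nat \<Rightarrow> real" where
  "radius A n \<equiv> snd (A n)"

(* The set underlying the space of abstract Swiss cheeses; its product topology is not needed. *)
definition swiss_cheeses :: "discs set" where
  "swiss_cheeses = {A. \<forall>n. 0 \<le> radius A n}"

definition positive_indices :: "discs \<Rightarrow> nat set" where
  "positive_indices A = {n. 1 \<le> n \<and> 0 < radius A n}"

definition cheese_set :: "discs \<Rightarrow> complex set" where
  "cheese_set A = cball (centre A 0) (radius A 0) - (\<Union>n\<in>{1..}. ball (centre A n) (radius A n))"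

(* The supremum and the sum below may be infinite, hence the extended reals. *)
definition mu :: "discs \<Rightarrow> ereal" where
  "mu A = (SUP n\<in>{1..}. ereal (norm (centre A n)))"

definition rho_ann :: "discs \<Rightarrow> ereal" where
  "rho_ann A = (\<Sum>n. ereal (radius A (n + 2)))"

definition delta_ann :: "discs \<Rightarrow> ereal" where
  "delta_ann A = ereal (radius A 0) - ereal (radius A 1) - 2 * rho_ann A"

definition annular :: "discs \<Rightarrow> bool" where
  "annular A \<longleftrightarrow> A \<in> swiss_cheeses \<and> centre A 0 = centre A 1 \<and>
     0 < radius A 1 \<and> radius A 1 < radius A 0"

definition classical :: "discs \<Rightarrow> bool" where
  "classical A \<longleftrightarrow> A \<in> swiss_cheeses \<and> summable (\<lambda>n. radius A (n + 1)) \<and> 0 < radius A 0 \<and>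
     (\<forall>k\<in>positive_indices A.
        cball (centre A k) (radius A k) \<subseteq> ball (centre A 0) (radius A 0) \<and>
        (\<forall>l\<in>positive_indices A. l \<noteq> k \<longrightarrow>
           cball (centre A k) (radius A k) \<inter> cball (centre A l) (radius A l) = {}))"

definition partially_above :: "discs \<Rightarrow> discs \<Rightarrow> bool" where
  "partially_above B A \<longleftrightarrow>
     cball (centre B 0) (radius B 0) \<subseteq> cball (centre A 0) (radius A 0) \<and>
     (\<forall>n\<ge>1. ball (centre A n) (radius A n) \<subseteq> - cball (centre B 0) (radius B 0) \<or>
        (\<exists>m\<ge>1. ball (centre A n) (radius A n) \<subseteq> ball (centre B m) (radius B m)))"

definition annular_family :: "discs \<Rightarrow> discs set" where
  "annular_family A = {B \<in> swiss_cheeses.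
     antimono_on {2..} (radius B) \<and>
     rho_ann B \<le> rho_ann A \<and>
     mu B \<le> mu A \<and>
     partially_above B A \<and>
     centre B 0 = centre B 1 \<and> centre B 1 = centre A 0 \<and>
     radius A 0 \<ge> radius B 0 \<and> radius B 0 \<ge> radius B 1 \<and> radius B 1 \<ge> radius A 1}"

end

theory Submission
  imports Defs
begin

text \<open>
  Consider the cheeses that arise from \<open>A\<close> when the annulus boundary may absorb a disc of radius
  \<open>s\<close> at the cost of \<open>2 s\<close> in \<open>s\<^sub>0 - s\<^sub>1\<close>, and two discs may be replaced by the disc around their
  weighted centroid whose radius is the sum of theirs. Neither operation decreases the annular
  discrepancy. Dropping the monotonicity of the radii, the conditions defining these cheeses
  can be arranged to form a compact set in the product topology, on which a weighted sum of
  radii attains its maximum. At a maximum no operation applies, so the closed discs are disjoint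
  from each other and from the annulus boundary. The radii are sorted only at the very end.
\<close>

section \<open>Decreasing rearrangements\<close>

text \<open>If \<open>f i > 0\<close> for some \<open>i\<close> in \<open>S\<close>, only finitely
  many indices carry a value of at least \<open>f i\<close>, and a maximum over those in
  \<open>S\<close> is one over all of \<open>S\<close>. Otherwise \<open>f\<close> vanishes on
  \<open>S\<close> and any element will do.\<close>

lemma ex_argmax_of_tendsto_zero:
  fixes f :: "nat \<Rightarrow> real"
  assumes "\<And>n. 0 \<le> f n" "f \<longlonglongrightarrow> 0" "S \<noteq> {}"
  shows "\<exists>i\<in>S. \<forall>j\<in>S. f j \<le> f i"
proof (cases "\<exists>i\<in>S. f i > 0")
  case True
  then obtain i where i: "i \<in> S" "f i > 0" by blast
  have "eventually (\<lambda>n. f n < f i) sequentially"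
    using assms(2) i(2) by (simp add: order_tendstoD(2))
  then obtain N where N: "\<And>n. n \<ge> N \<Longrightarrow> f n < f i"
    unfolding eventually_sequentially by blast
  let ?T = "{n\<in>S. n < N}"
  have "i \<in> ?T" using N[of i] i by force
  then have "finite (f ` ?T)" "f ` ?T \<noteq> {}" by auto
  then obtain j where j: "j \<in> ?T" "\<And>n. n \<in> ?T \<Longrightarrow> f n \<le> f j"
    using Max_in[of "f ` ?T"] Max_ge[of "f ` ?T"] by (metis (no_types, lifting) imageE imageI)
  have "f n \<le> f j" if "n \<in> S" for n
    using N[of n] j(2)[of n] j(2)[of i] \<open>i \<in> ?T\<close> that by force
  then show ?thesis using j(1) by blast
next
  case False
  then show ?thesis using assms(1,3) by (metis all_not_in_conv linorder_not_less order_trans)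
qed

text \<open>Greedy selection: \<open>\<sigma> n\<close> is an index of largest value among those not
  yet chosen. An index of positive value that is never chosen would bound
  \<open>f (\<sigma> k)\<close> from below for all \<open>k\<close>, which convergence to zero rules
  out since \<open>\<sigma>\<close> takes infinitely many values. Indices of value zero may be
  missed, so \<open>\<sigma>\<close> need not be onto.\<close>

lemma ex_decreasing_rearrangement:
  fixes f :: "nat \<Rightarrow> real"
  assumes nonneg: "\<And>n. 0 \<le> f n" and lim: "f \<longlonglongrightarrow> 0"
  shows "\<exists>\<sigma> :: nat \<Rightarrow> nat. inj \<sigma> \<and> antimono (f \<circ> \<sigma>) \<and> {n. 0 < f n} \<subseteq> range \<sigma>"
proof -
  have "\<exists>\<sigma> :: nat \<Rightarrow> nat. \<forall>n. \<sigma> n \<notin> \<sigma> ` {..<n} \<and> (\<forall>j. j \<notin> \<sigma> ` {..<n} \<longrightarrow> f j \<le> f (\<sigma> n))"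
  proof (rule dependent_wellorder_choice)
    fix r n :: nat and g h :: "nat \<Rightarrow> nat"
    assume "\<And>y. y < n \<Longrightarrow> g y = h y"
    then have "g ` {..<n} = h ` {..<n}" by (intro image_cong) auto
    then show "(r \<notin> g ` {..<n} \<and> (\<forall>j. j \<notin> g ` {..<n} \<longrightarrow> f j \<le> f r)) =
       (r \<notin> h ` {..<n} \<and> (\<forall>j. j \<notin> h ` {..<n} \<longrightarrow> f j \<le> f r))" by simp
  next
    fix x :: nat and g :: "nat \<Rightarrow> nat"
    have "- (g ` {..<x}) \<noteq> {}"
      by (metis finite_imageI finite_lessThan finite_compl infinite_UNIV_nat finite.emptyI)
    from ex_argmax_of_tendsto_zero[OF nonneg lim this]
    show "\<exists>r. r \<notin> g ` {..<x} \<and> (\<forall>j. j \<notin> g ` {..<x} \<longrightarrow> f j \<le> f r)" by auto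
  qed
  then obtain \<sigma> :: "nat \<Rightarrow> nat"
    where \<sigma>: "\<forall>n. \<sigma> n \<notin> \<sigma> ` {..<n} \<and> (\<forall>j. j \<notin> \<sigma> ` {..<n} \<longrightarrow> f j \<le> f (\<sigma> n))" ..
  have new: "\<sigma> n \<notin> \<sigma> ` {..<n}" for n using \<sigma> by simp
  have best: "f j \<le> f (\<sigma> n)" if "j \<notin> \<sigma> ` {..<n}" for n j using \<sigma> that by simp
  have "inj \<sigma>"
  proof (rule injI)
    fix x y assume "\<sigma> x = \<sigma> y"
    then show "x = y"
      using new[of x] new[of y] by (metis imageI lessThan_iff linorder_cases)
  qed
  moreover have "antimono (f \<circ> \<sigma>)"
  proof (rule antimonoI)
    fix x y :: nat assume "x \<le> y"
    then have "\<sigma> y \<notin> \<sigma> ` {..<x}" using new[of y] by auto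
    then show "(f \<circ> \<sigma>) y \<le> (f \<circ> \<sigma>) x" using best by simp
  qed
  moreover have "n \<in> range \<sigma>" if "0 < f n" for n
  proof (rule ccontr)
    assume "n \<notin> range \<sigma>"
    then have ge: "f n \<le> f (\<sigma> k)" for k using best[of n k] by blast
    have "eventually (\<lambda>k. f k < f n) sequentially"
      using lim that by (simp add: order_tendstoD(2))
    then obtain N where "\<And>k. N \<le> k \<Longrightarrow> f k < f n"
      unfolding eventually_sequentially by blast
    with ge have "range \<sigma> \<subseteq> {..<N}" by (force simp: not_less[symmetric])
    then show False
      using \<open>inj \<sigma>\<close> by (meson finite_imageD finite_lessThan finite_subset infinite_UNIV_nat)
  qed
  ultimately show ?thesis by (intro exI[of _ \<sigma>]) auto
qed

section \<open>Configurations\<close>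

lemma sums_add_at:
  fixes f :: "nat \<Rightarrow> real"
  assumes "f sums s"
  shows "(\<lambda>n. f n + (if n = k then d else 0)) sums (s + d)"
  using sums_add[OF assms sums_single[of k "\<lambda>_. d"]] by simp

text \<open>
  Bounding the index of the covering disc by \<open>m \<le> n\<close> makes this set closed in the product
  topology: otherwise covering discs could escape to infinity in a limit.
\<close>
definition configs :: "discs \<Rightarrow> real \<Rightarrow> real \<Rightarrow> discs set" where
  "configs A M \<delta> = {B.
     centre B 0 = centre A 0 \<and> centre B 1 = centre A 0 \<and>
     radius B 0 \<le> radius A 0 \<and> radius A 1 \<le> radius B 1 \<and>
     (\<forall>n. 0 \<le> radius B n \<and> norm (centre B n) \<le> M) \<and>
     (\<forall>N. \<delta> + 2 * (\<Sum>n<N. radius B (n + 2)) \<le> radius B 0 - radius B 1) \<and>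
     (\<forall>n. 0 < radius A (n + 2) \<longrightarrow>
        radius B 0 + radius A (n + 2) \<le> dist (centre A (n + 2)) (centre A 0) \<or>
        dist (centre A (n + 2)) (centre A 0) + radius A (n + 2) \<le> radius B 1 \<or>
        (\<exists>m\<le>n. dist (centre A (n + 2)) (centre B (m + 2)) + radius A (n + 2) \<le> radius B (m + 2)))}"

text \<open>The definition bounds partial sums, each continuous as a function of finitely many
  coordinates. Since the radii are nonnegative, the uniform bound gives summability and the same
  bound for the whole series.\<close>

lemma configsD:
  assumes "B \<in> configs A M \<delta>"
  shows "centre B 0 = centre A 0" "centre B 1 = centre A 0"
    "radius B 0 \<le> radius A 0" "radius A 1 \<le> radius B 1"
    "\<And>n. 0 \<le> radius B n" "\<And>n. norm (centre B n) \<le> M"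
    "summable (\<lambda>n. radius B (n + 2))"
    "\<delta> + 2 * (\<Sum>n. radius B (n + 2)) \<le> radius B 0 - radius B 1"
    "\<And>n. 0 < radius A (n + 2) \<Longrightarrow>
        radius B 0 + radius A (n + 2) \<le> dist (centre A (n + 2)) (centre A 0) \<or>
        dist (centre A (n + 2)) (centre A 0) + radius A (n + 2) \<le> radius B 1 \<or>
        (\<exists>m\<le>n. dist (centre A (n + 2)) (centre B (m + 2)) + radius A (n + 2) \<le> radius B (m + 2))"
proof -
  show nonneg: "\<And>n. 0 \<le> radius B n" using assms by (simp add: configs_def)
  have "\<delta> + 2 * (\<Sum>n<N. radius B (n + 2)) \<le> radius B 0 - radius B 1" for N
    using assms by (simp add: configs_def)
  then have bound: "(\<Sum>n<N. radius B (n + 2)) \<le> (radius B 0 - radius B 1 - \<delta>) / 2" for N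
    by (simp add: field_simps)
  show summ: "summable (\<lambda>n. radius B (n + 2))"
    by (rule summableI_nonneg_bounded[OF nonneg bound])
  show "\<delta> + 2 * (\<Sum>n. radius B (n + 2)) \<le> radius B 0 - radius B 1"
    using suminf_le_const[OF summ bound] by (simp add: field_simps)
qed (use assms in \<open>auto simp: configs_def\<close>)

lemma configsI:
  assumes "centre B 0 = centre A 0" "centre B 1 = centre A 0"
    "radius B 0 \<le> radius A 0" "radius A 1 \<le> radius B 1"
    and nonneg: "\<And>n. 0 \<le> radius B n" and "\<And>n. norm (centre B n) \<le> M"
    and sums: "(\<lambda>n. radius B (n + 2)) sums s"
    and le: "\<delta> + 2 * s \<le> radius B 0 - radius B 1"
    and "\<And>n. 0 < radius A (n + 2) \<Longrightarrow>
        radius B 0 + radius A (n + 2) \<le> dist (centre A (n + 2)) (centre A 0) \<or>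
        dist (centre A (n + 2)) (centre A 0) + radius A (n + 2) \<le> radius B 1 \<or>
        (\<exists>m\<le>n. dist (centre A (n + 2)) (centre B (m + 2)) + radius A (n + 2) \<le> radius B (m + 2))"
  shows "B \<in> configs A M \<delta>"
proof -
  have "\<delta> + 2 * (\<Sum>n<N. radius B (n + 2)) \<le> radius B 0 - radius B 1" for N
    using sum_le_suminf[OF sums_summable[OF sums], of "{..<N}"] nonneg le sums_unique[OF sums] by auto
  then show ?thesis using assms unfolding configs_def by blast
qed

text \<open>A single radius is at most the sum of all, which the gap
  \<open>radius B 0 - radius B 1\<close> controls. The uniform bound provides both the compact box
  and the majorant for the potential.\<close>

lemma configs_radius_le:
  assumes "B \<in> configs A M \<delta>" "0 \<le> \<delta>"
  shows "radius B n \<le> radius A 0"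
proof -
  note B = configsD[OF assms(1)]
  have nonneg: "0 \<le> (\<Sum>n. radius B (n + 2))" using suminf_nonneg[OF B(7)] B(5) by blast
  consider "n = 0" | "n = 1" | m where "n = m + 2"
    by (metis One_nat_def add_2_eq_Suc' not0_implies_Suc)
  then show ?thesis
  proof cases
    case 3
    have "radius B (m + 2) \<le> (\<Sum>n. radius B (n + 2))"
      using sum_le_suminf[OF B(7), of "{m}"] B(5) by auto
    then show ?thesis using B(3,8) B(5)[of 1] assms(2) nonneg unfolding 3 by linarith
  qed (use B(3,8) assms(2) nonneg in auto)
qed

lemma closed_Collect_ex_le:
  fixes n :: nat
  assumes "\<And>m. closed {x. P m x}"
  shows "closed {x. \<exists>m\<le>n. P m x}"
proof -
  have "closed (\<Union>m\<le>n. {x. P m x})" using assms by auto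
  moreover have "(\<Union>m\<le>n. {x. P m x}) = {x. \<exists>m\<le>n. P m x}" by auto
  ultimately show ?thesis by simp
qed

text \<open>The box is compact by Tychonoff's theorem. The configurations are closed in it because
  every condition is an equation or nonstrict inequality between continuous functions of finitely
  many coordinates; the strict premise \<open>0 < radius A (n + 2)\<close> does not involve
  \<open>B\<close>.\<close>

lemma compact_configs:
  assumes "0 \<le> \<delta>"
  shows "compact (configs A M \<delta>)"
proof -
  let ?box = "(UNIV::nat set) \<rightarrow>\<^sub>E cball (0::complex) M \<times> {0..radius A 0}"
  have "compactin (product_topology (\<lambda>_. euclidean) UNIV) ?box"
    unfolding compactin_PiE by (auto intro!: compact_Times)
  then have "compact ?box" by (simp add: euclidean_product_topology)
  moreover have "closed (configs A M \<delta>)"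
    unfolding configs_def
    by (intro closed_Collect_conj closed_Collect_all closed_Collect_imp closed_Collect_disj
        closed_Collect_le closed_Collect_eq closed_Collect_ex_le continuous_intros
        continuous_on_product_coordinates open_Collect_const)
  moreover have "configs A M \<delta> \<subseteq> ?box"
  proof
    fix B assume B: "B \<in> configs A M \<delta>"
    show "B \<in> ?box"
      using configs_radius_le[OF B assms] configsD(5,6)[OF B] by (auto simp: mem_Times_iff)
  qed
  ultimately show ?thesis by (metis compact_Int_closed inf.absorb2)
qed

section \<open>Maximising the potential\<close>

text \<open>
  The weights decrease strictly and stay below 2, so both absorbing a disc into the annulus
  boundary and merging two discs into the one of smaller index raise the potential.
\<close>
definition potential :: "discs \<Rightarrow> real" where
  "potential B = radius B 1 - radius B 0 + (\<Sum>n. (1/2) ^ n * radius B (n + 2))"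

lemma configs_summable_weighted:
  assumes "B \<in> configs A M \<delta>"
  shows "summable (\<lambda>n. (1/2) ^ n * radius B (n + 2))"
proof (rule summable_comparison_test'[OF configsD(7)[OF assms]])
  fix n :: nat assume "n \<ge> 0"
  show "norm ((1/2) ^ n * radius B (n + 2)) \<le> radius B (n + 2)"
    using configsD(5)[OF assms] by (simp add: abs_mult mult_left_le_one_le power_le_one)
qed

text \<open>The geometric weights and the uniform bound on the radii give a summable majorant, so
  the series converges uniformly and inherits continuity from its partial sums.\<close>

lemma continuous_on_potential:
  assumes "0 \<le> \<delta>"
  shows "continuous_on (configs A M \<delta>) potential"
proof -
  have coord: "continuous_on (configs A M \<delta>) (\<lambda>B. B n)" for n
    by (rule continuous_on_subset[OF continuous_on_product_coordinates]) simp
  have "uniform_limit (configs A M \<delta>) (\<lambda>N B. \<Sum>n<N. (1/2) ^ n * radius B (n + 2))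
      (\<lambda>B. \<Sum>n. (1/2) ^ n * radius B (n + 2)) sequentially"
  proof (rule Weierstrass_m_test)
    show "summable (\<lambda>n. (1/2::real) ^ n * radius A 0)"
      by (intro summable_mult2 summable_geometric) simp
    show "norm ((1/2) ^ n * radius B (n + 2)) \<le> (1/2) ^ n * radius A 0"
      if "B \<in> configs A M \<delta>" for n B
      using configs_radius_le[OF that assms] configsD(5)[OF that] by (simp add: abs_mult)
  qed
  then have "continuous_on (configs A M \<delta>) (\<lambda>B. \<Sum>n. (1/2) ^ n * radius B (n + 2))"
    by (rule uniform_limit_theorem[rotated])
      (auto intro!: always_eventually continuous_intros coord)
  then show ?thesis
    unfolding potential_def[abs_def] by (intro continuous_intros coord)
qed

section \<open>Absorbing a disc into the annulus boundary\<close>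

text \<open>Common core of absorption at the outer and at the inner circle, with \<open>t0\<close>
  and \<open>t1\<close> the new radii of the two. Deleting a disc of radius \<open>s\<close> frees
  \<open>2 * s\<close> in the gap condition, exactly what the narrower annulus costs. In the
  potential, the first two terms gain \<open>2 * s\<close> and the weighted sum loses at most
  \<open>s\<close>.\<close>

lemma absorb_disc:
  assumes B: "B \<in> configs A M \<delta>" and "0 \<le> \<delta>" and pos: "0 < radius B (k + 2)"
    and t: "t0 \<le> radius B 0" "radius B 1 \<le> t1" "t0 - t1 = radius B 0 - radius B 1 - 2 * radius B (k + 2)"
    and cover: "\<And>a r. dist a (centre B (k + 2)) + r \<le> radius B (k + 2) \<Longrightarrow>
      t0 + r \<le> dist a (centre A 0) \<or> dist a (centre A 0) + r \<le> t1"
  shows "\<exists>C\<in>configs A M \<delta>. potential B < potential C"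
proof -
  note D = configsD[OF B]
  define C where "C = B(0 := (centre A 0, t0), 1 := (centre A 0, t1), k + 2 := (centre B (k + 2), 0))"
  have rad: "radius C (n + 2) = radius B (n + 2) + (if n = k then - radius B (k + 2) else 0)" for n
    by (simp add: C_def)
  have C01: "radius C 0 = t0" "radius C 1 = t1" and cen: "centre C n = centre B n" for n
    using D(1,2) by (auto simp: C_def)
  have sums: "(\<lambda>n. radius C (n + 2)) sums ((\<Sum>n. radius B (n + 2)) + - radius B (k + 2))"
    unfolding rad by (rule sums_add_at[OF summable_sums[OF D(7)]])
  \<comment> \<open>With the gap condition this gives \<open>t1 \<le> t0\<close>, so that
    \<open>t0\<close> is nonnegative.\<close>
  have le: "radius B (k + 2) \<le> (\<Sum>n. radius B (n + 2))"
    using sum_le_suminf[OF D(7), of "{k}"] D(5) by auto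
  have "C \<in> configs A M \<delta>"
  proof (rule configsI[OF _ _ _ _ _ _ sums])
    have "0 \<le> t1" using t(2) D(5)[of 1] by linarith
    moreover from this have "0 \<le> t0" using t(3) le D(8) \<open>0 \<le> \<delta>\<close> by linarith
    ultimately show "0 \<le> radius C n" for n
      using D(5)[of n] by (auto simp: C_def)
    show "radius C 0 \<le> radius A 0" "radius A 1 \<le> radius C 1"
      using D(3,4) t(1,2) unfolding C01 by linarith+
    show "\<delta> + 2 * ((\<Sum>n. radius B (n + 2)) + - radius B (k + 2)) \<le> radius C 0 - radius C 1"
      using t(3) D(8) unfolding C01 distrib_left by linarith
    fix n assume n: "0 < radius A (n + 2)"
    show "radius C 0 + radius A (n + 2) \<le> dist (centre A (n + 2)) (centre A 0) \<or>
        dist (centre A (n + 2)) (centre A 0) + radius A (n + 2) \<le> radius C 1 \<or>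
        (\<exists>m\<le>n. dist (centre A (n + 2)) (centre C (m + 2)) + radius A (n + 2) \<le> radius C (m + 2))"
      using D(9)[OF n]
    proof (elim disjE exE conjE)
      fix m assume m: "m \<le> n"
        "dist (centre A (n + 2)) (centre B (m + 2)) + radius A (n + 2) \<le> radius B (m + 2)"
      show ?thesis
      proof (cases "m = k")
        case True
        then show ?thesis using cover m(2) unfolding C01 by blast
      next
        case False
        then have "C (m + 2) = B (m + 2)" by (simp add: C_def)
        then show ?thesis using m by metis
      qed
    next
      assume "radius B 0 + radius A (n + 2) \<le> dist (centre A (n + 2)) (centre A 0)"
      then show ?thesis using t(1) unfolding C01 by linarith
    next
      assume "dist (centre A (n + 2)) (centre A 0) + radius A (n + 2) \<le> radius B 1"
      then show ?thesis using t(2) unfolding C01 by linarith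
    qed
  qed (unfold cen, (rule D)+)
  moreover have "potential B < potential C"
  proof -
    have "(1/2) ^ n * radius C (n + 2) = (1/2) ^ n * radius B (n + 2) +
        (if n = k then - ((1/2) ^ k * radius B (k + 2)) else 0)" for n
      unfolding rad by (simp add: algebra_simps)
    then have "(\<lambda>n. (1/2) ^ n * radius C (n + 2)) sums
        ((\<Sum>n. (1/2) ^ n * radius B (n + 2)) + - ((1/2) ^ k * radius B (k + 2)))"
      by (simp only:) (intro sums_add_at summable_sums configs_summable_weighted[OF B])
    then have "(\<Sum>n. (1/2) ^ n * radius C (n + 2)) =
        (\<Sum>n. (1/2) ^ n * radius B (n + 2)) + - ((1/2) ^ k * radius B (k + 2))"
      by (rule sums_unique[symmetric])
    moreover have "(1/2) ^ k * radius B (k + 2) \<le> radius B (k + 2)"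
      using pos by (simp add: mult_left_le_one_le power_le_one)
    ultimately show ?thesis using pos t(3) unfolding potential_def C01 by linarith
  qed
  ultimately show ?thesis by blast
qed

text \<open>Every point of a disc that reaches the outer circle is within one diameter of that
  circle or beyond it. Shrinking the outer disc by the diameter thus leaves the whole open disc
  outside.\<close>

lemma absorb_outer:
  assumes B: "B \<in> configs A M \<delta>" and "0 \<le> \<delta>" and pos: "0 < radius B (k + 2)"
    and touch: "radius B 0 \<le> dist (centre B (k + 2)) (centre A 0) + radius B (k + 2)"
  shows "\<exists>C\<in>configs A M \<delta>. potential B < potential C"
proof (rule absorb_disc[OF B \<open>0 \<le> \<delta>\<close> pos])
  fix a r assume "dist a (centre B (k + 2)) + r \<le> radius B (k + 2)"
  then have "radius B 0 - 2 * radius B (k + 2) + r \<le> dist a (centre A 0)"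
    using touch dist_triangle3[of "centre B (k + 2)" "centre A 0" a] by linarith
  then show "radius B 0 - 2 * radius B (k + 2) + r \<le> dist a (centre A 0) \<or>
      dist a (centre A 0) + r \<le> radius B 1" ..
qed (use pos in auto)

text \<open>Dually, a disc that reaches the inner disc is swallowed once the inner radius grows by
  the diameter.\<close>

lemma absorb_inner:
  assumes B: "B \<in> configs A M \<delta>" and "0 \<le> \<delta>" and pos: "0 < radius B (k + 2)"
    and touch: "dist (centre B (k + 2)) (centre A 0) \<le> radius B 1 + radius B (k + 2)"
  shows "\<exists>C\<in>configs A M \<delta>. potential B < potential C"
proof (rule absorb_disc[OF B \<open>0 \<le> \<delta>\<close> pos])
  fix a r assume "dist a (centre B (k + 2)) + r \<le> radius B (k + 2)"
  then have "dist a (centre A 0) + r \<le> radius B 1 + 2 * radius B (k + 2)"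
    using touch dist_triangle[of a "centre A 0" "centre B (k + 2)"] by linarith
  then show "radius B 0 + r \<le> dist a (centre A 0) \<or>
      dist a (centre A 0) + r \<le> radius B 1 + 2 * radius B (k + 2)" ..
qed (use pos in auto)

section \<open>Merging two discs\<close>

text \<open>The centroid divides the segment from \<open>a\<close> to \<open>b\<close> in the ratio
  \<open>s\<close> to \<open>r\<close>. The two estimates say that the disc of radius
  \<open>r + s\<close> around it contains the discs of radius \<open>r\<close> around
  \<open>a\<close> and of radius \<open>s\<close> around \<open>b\<close>.\<close>

lemma weighted_centroid_dist:
  fixes a b :: "'a::real_normed_vector"
  assumes "0 < r" "0 < s" "dist a b \<le> r + s"
  shows "dist a ((r / (r + s)) *\<^sub>R a + (s / (r + s)) *\<^sub>R b) \<le> s"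
    and "dist b ((r / (r + s)) *\<^sub>R a + (s / (r + s)) *\<^sub>R b) \<le> r"
proof -
  have one: "r / (r + s) = 1 - s / (r + s)" using assms by (simp add: field_simps)
  have "a - ((r / (r + s)) *\<^sub>R a + (s / (r + s)) *\<^sub>R b) = (s / (r + s)) *\<^sub>R (a - b)"
    unfolding one by (simp add: algebra_simps)
  then have "dist a ((r / (r + s)) *\<^sub>R a + (s / (r + s)) *\<^sub>R b) = s * (dist a b / (r + s))"
    using assms by (simp add: dist_norm)
  also have "\<dots> \<le> s * 1" using assms by (intro mult_left_mono) auto
  finally show "dist a ((r / (r + s)) *\<^sub>R a + (s / (r + s)) *\<^sub>R b) \<le> s" by simp
  have one': "s / (r + s) = 1 - r / (r + s)" using assms by (simp add: field_simps)
  have "b - ((r / (r + s)) *\<^sub>R a + (s / (r + s)) *\<^sub>R b) = (r / (r + s)) *\<^sub>R (b - a)"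
    unfolding one' by (simp add: algebra_simps)
  then have "dist b ((r / (r + s)) *\<^sub>R a + (s / (r + s)) *\<^sub>R b) = r * (dist a b / (r + s))"
    using assms by (simp add: dist_norm norm_minus_commute)
  also have "\<dots> \<le> r * 1" using assms by (intro mult_left_mono) auto
  finally show "dist b ((r / (r + s)) *\<^sub>R a + (s / (r + s)) *\<^sub>R b) \<le> r" by simp
qed

text \<open>The merged disc takes the smaller index \<open>k\<close>, and index \<open>l\<close> is
  left with radius zero. The total of the radii is unchanged, so the gap condition persists, while
  radius moves from weight \<open>(1/2) ^ l\<close> to the larger weight
  \<open>(1/2) ^ k\<close>.\<close>

lemma merge_discs:
  assumes B: "B \<in> configs A M \<delta>" and "k < l"
    and touch: "dist (centre B (k + 2)) (centre B (l + 2)) \<le> radius B (k + 2) + radius B (l + 2)"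
    and pos: "0 < radius B (k + 2)" "0 < radius B (l + 2)"
  shows "\<exists>C\<in>configs A M \<delta>. potential B < potential C"
proof -
  note D = configsD[OF B]
  let ?r = "radius B (k + 2)" and ?s = "radius B (l + 2)"
  define c where "c = (?r / (?r + ?s)) *\<^sub>R centre B (k + 2) + (?s / (?r + ?s)) *\<^sub>R centre B (l + 2)"
  note c = weighted_centroid_dist[OF pos touch, folded c_def]
  define C where "C = B(k + 2 := (c, ?r + ?s), l + 2 := (centre B (l + 2), 0))"
  have rad: "radius C (n + 2) = radius B (n + 2) + (if n = k then ?s else 0)
      + (if n = l then - ?s else 0)" for n
    using \<open>k < l\<close> by (simp add: C_def)
  have C01: "C 0 = B 0" "C 1 = B 1" by (auto simp: C_def)
  \<comment> \<open>The new centre is a convex combination of two points of a disc, so the bound on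
    the centres survives.\<close>
  have "c \<in> cball 0 M"
    unfolding c_def
    by (rule convexD[OF convex_cball]) (use D(6) pos in \<open>auto simp: add_divide_distrib[symmetric]\<close>)
  then have cM: "norm c \<le> M" by simp
  have sums: "(\<lambda>n. radius C (n + 2)) sums ((\<Sum>n. radius B (n + 2)) + ?s + - ?s)"
    unfolding rad by (intro sums_add_at summable_sums D(7))
  have "C \<in> configs A M \<delta>"
  proof (rule configsI[OF _ _ _ _ _ _ sums])
    show "0 \<le> radius C n" "norm (centre C n) \<le> M" for n
      using D(5,6)[of n] pos cM by (auto simp: C_def)
    show "\<delta> + 2 * ((\<Sum>n. radius B (n + 2)) + ?s + - ?s) \<le> radius C 0 - radius C 1"
      using D(8) unfolding C01 by (simp only: add_minus_cancel add.assoc right_minus add_0_right)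
    fix n assume n: "0 < radius A (n + 2)"
    have hull: "dist (centre A (n + 2)) (centre C (k + 2)) + radius A (n + 2) \<le> radius C (k + 2)"
      if "m = k \<or> m = l"
        "dist (centre A (n + 2)) (centre B (m + 2)) + radius A (n + 2) \<le> radius B (m + 2)" for m
      using that c dist_triangle[of "centre A (n + 2)" c "centre B (m + 2)"] \<open>k < l\<close>
      by (auto simp: C_def)
    show "radius C 0 + radius A (n + 2) \<le> dist (centre A (n + 2)) (centre A 0) \<or>
        dist (centre A (n + 2)) (centre A 0) + radius A (n + 2) \<le> radius C 1 \<or>
        (\<exists>m\<le>n. dist (centre A (n + 2)) (centre C (m + 2)) + radius A (n + 2) \<le> radius C (m + 2))"
      using D(9)[OF n]
    proof (elim disjE exE conjE)
      fix m assume m: "m \<le> n"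
        "dist (centre A (n + 2)) (centre B (m + 2)) + radius A (n + 2) \<le> radius B (m + 2)"
      show ?thesis
      proof (cases "m = k \<or> m = l")
        case True
        \<comment> \<open>The choice of the smaller index matters here: a covering index
          \<open>l \<le> n\<close> is replaced by \<open>k < l\<close>, which respects the
          bound.\<close>
        then have "k \<le> n" using m(1) \<open>k < l\<close> by auto
        then show ?thesis using hull[OF True m(2)] by blast
      next
        case False
        then have "C (m + 2) = B (m + 2)" by (simp add: C_def)
        then show ?thesis using m by metis
      qed
    qed (auto simp only: C01)
  qed (unfold C01, (rule D)+)
  moreover have "potential B < potential C"
  proof -
    have "(1/2) ^ n * radius C (n + 2) = (1/2) ^ n * radius B (n + 2) +
        (if n = k then (1/2) ^ k * ?s else 0) + (if n = l then - ((1/2) ^ l * ?s) else 0)" for n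
      unfolding rad by (simp add: algebra_simps)
    then have "(\<lambda>n. (1/2) ^ n * radius C (n + 2)) sums
        ((\<Sum>n. (1/2) ^ n * radius B (n + 2)) + (1/2) ^ k * ?s + - ((1/2) ^ l * ?s))"
      by (simp only:) (intro sums_add_at summable_sums configs_summable_weighted[OF B])
    then have "(\<Sum>n. (1/2) ^ n * radius C (n + 2)) =
        (\<Sum>n. (1/2) ^ n * radius B (n + 2)) + (1/2) ^ k * ?s + - ((1/2) ^ l * ?s)"
      by (rule sums_unique[symmetric])
    moreover have "(1/2) ^ l * ?s < (1/2) ^ k * ?s"
      using pos \<open>k < l\<close> by (intro mult_strict_right_mono power_strict_decreasing) auto
    ultimately show ?thesis unfolding potential_def C01 by linarith
  qed
  ultimately show ?thesis by blast
qed

section \<open>Separation at a maximum\<close>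

text \<open>A maximiser of the potential exists by compactness and admits neither absorption nor
  merging. Both moves already apply at tangency, which is why all the resulting inequalities are
  strict.\<close>

lemma ex_separated_config:
  assumes "B0 \<in> configs A M \<delta>" and "0 \<le> \<delta>"
  shows "\<exists>B\<in>configs A M \<delta>.
    (\<forall>k. 0 < radius B (k + 2) \<longrightarrow>
       dist (centre B (k + 2)) (centre A 0) + radius B (k + 2) < radius B 0 \<and>
       radius B 1 + radius B (k + 2) < dist (centre B (k + 2)) (centre A 0)) \<and>
    (\<forall>k l. k \<noteq> l \<longrightarrow> 0 < radius B (k + 2) \<longrightarrow> 0 < radius B (l + 2) \<longrightarrow>
       radius B (k + 2) + radius B (l + 2) < dist (centre B (k + 2)) (centre B (l + 2)))"
proof -
  obtain B where B: "B \<in> configs A M \<delta>"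
    and max: "\<And>C. C \<in> configs A M \<delta> \<Longrightarrow> potential C \<le> potential B"
    using continuous_attains_sup[OF compact_configs[OF \<open>0 \<le> \<delta>\<close>] _ continuous_on_potential[OF \<open>0 \<le> \<delta>\<close>]]
      assms(1) by (metis empty_iff)
  have stuck: "\<not> (\<exists>C\<in>configs A M \<delta>. potential B < potential C)"
    using max by (auto simp: not_less)
  show ?thesis
  proof (intro bexI[OF _ B] conjI allI impI)
    fix k l :: nat
    assume *: "k \<noteq> l" "0 < radius B (k + 2)" "0 < radius B (l + 2)"
    show "radius B (k + 2) + radius B (l + 2) < dist (centre B (k + 2)) (centre B (l + 2))"
    proof (rule ccontr)
      assume "\<not> ?thesis"
      then have touch: "dist (centre B (k + 2)) (centre B (l + 2)) \<le> radius B (k + 2) + radius B (l + 2)"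
        unfolding not_less .
      then have touch': "dist (centre B (l + 2)) (centre B (k + 2)) \<le> radius B (l + 2) + radius B (k + 2)"
        by (subst dist_commute, subst add.commute)
      from \<open>k \<noteq> l\<close> have "k < l \<or> l < k" by linarith
      then show False
        using merge_discs[OF B _ touch *(2,3)] merge_discs[OF B _ touch' *(3,2)] stuck by blast
    qed
  next
    fix k assume pos: "0 < radius B (k + 2)"
    have "\<not> radius B 0 \<le> dist (centre B (k + 2)) (centre A 0) + radius B (k + 2)"
      using absorb_outer[OF B \<open>0 \<le> \<delta>\<close> pos] stuck by blast
    then show "dist (centre B (k + 2)) (centre A 0) + radius B (k + 2) < radius B 0"
      unfolding not_le .
    have "\<not> dist (centre B (k + 2)) (centre A 0) \<le> radius B 1 + radius B (k + 2)"
      using absorb_inner[OF B \<open>0 \<le> \<delta>\<close> pos] stuck by blast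
    then show "radius B 1 + radius B (k + 2) < dist (centre B (k + 2)) (centre A 0)"
      unfolding not_le .
  qed
qed

section \<open>From configurations back to Swiss cheeses\<close>

lemma rho_ann_eq_ereal:
  assumes "summable (\<lambda>n. radius B (n + 2))"
  shows "rho_ann B = ereal (\<Sum>n. radius B (n + 2))"
  unfolding rho_ann_def
  by (rule sums_unique[symmetric]) (simp only: sums_ereal summable_sums[OF assms])

lemma disjoint_cballI:
  fixes a b :: "'a::euclidean_space"
  assumes "r + s < dist a b"
  shows "cball a r \<inter> cball b s = {}"
proof -
  have "False" if "x \<in> cball a r" "x \<in> cball b s" for x
    using that assms dist_triangle[of a b x] by (simp add: dist_commute)
  then show ?thesis by blast
qed

text \<open>A disc removed from \<open>A\<close> either misses the outer disc of \<open>B\<close> or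
  lies in a disc removed from \<open>B\<close>; in both cases it contains no point of
  \<open>cheese_set B\<close>.\<close>

lemma partially_above_cheese_set:
  assumes "partially_above B A"
  shows "cheese_set B \<subseteq> cheese_set A"
  using assms unfolding partially_above_def cheese_set_def by fast

theorem theorem6p6:
  fixes A :: discs
  assumes "annular A"
    and "delta_ann A > 0"
    and "mu A < \<infinity>"
    and "antimono_on {2..} (radius A)"
  shows "\<exists>B\<in>annular_family A. classical B \<and> annular B \<and>
    delta_ann B \<ge> delta_ann A \<and> cheese_set B \<subseteq> cheese_set A \<and>
    ereal (radius A 0) - 2 * rho_ann A \<le> ereal (radius B 0) \<and> radius B 0 \<le> radius A 0 \<and>
    radius A 1 \<le> radius B 1 \<and> ereal (radius B 1) \<le> ereal (radius A 1) + 2 * rho_ann A"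
proof -
  have nonneg: "0 \<le> radius A n" for n
    using \<open>annular A\<close> by (simp add: annular_def swiss_cheeses_def)
  have cen: "centre A 1 = centre A 0" and r1: "0 < radius A 1"
    using \<open>annular A\<close> by (auto simp: annular_def)
  \<comment> \<open>An infinite sum would make \<open>delta_ann A\<close> equal to minus
    infinity.\<close>
  have "rho_ann A \<noteq> \<infinity>"
    using \<open>delta_ann A > 0\<close> by (auto simp: delta_ann_def)
  then have summA: "summable (\<lambda>n. radius A (n + 2))"
    using nonneg unfolding rho_ann_def by (intro summable_ereal) auto
  define R where "R = (\<Sum>n. radius A (n + 2))"
  have rhoA: "rho_ann A = ereal R" unfolding R_def by (rule rho_ann_eq_ereal[OF summA])
  have "0 \<le> R" unfolding R_def using nonneg by (intro suminf_nonneg summA)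
  define \<delta> where "\<delta> = radius A 0 - radius A 1 - 2 * R"
  have deltaA: "delta_ann A = ereal \<delta>" by (simp add: delta_ann_def rhoA \<delta>_def)
  then have "0 < \<delta>" using \<open>delta_ann A > 0\<close> by simp
  have norm_le_mu: "ereal (norm (centre A n)) \<le> mu A" if "n \<ge> 1" for n
    unfolding mu_def using that by (intro SUP_upper) auto
  obtain M where M: "mu A = ereal M"
    using norm_le_mu[of 1] \<open>mu A < \<infinity>\<close> by (cases "mu A") auto
  \<comment> \<open>The supremum starts at index 1; index 0 shares the centre of index 1.\<close>
  have normA: "norm (centre A n) \<le> M" for n
    using norm_le_mu[of n] norm_le_mu[of 1] cen M by (cases "n = 0") auto

  \<comment> \<open>Each disc of \<open>A\<close> covers itself, with \<open>m = n\<close>, and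
    \<open>\<delta>\<close> makes the gap condition an equality in the limit.\<close>
  have "A \<in> configs A M \<delta>"
  proof (rule configsI[OF _ _ _ _ _ _ summable_sums[OF summA]])
    show "\<delta> + 2 * (\<Sum>n. radius A (n + 2)) \<le> radius A 0 - radius A 1"
      by (simp add: \<delta>_def R_def)
  qed (use cen nonneg normA in auto)
  from ex_separated_config[OF this less_imp_le[OF \<open>0 < \<delta>\<close>]]
  obtain B where B: "B \<in> configs A M \<delta>"
    and outer: "\<And>k. 0 < radius B (k + 2) \<Longrightarrow>
       dist (centre B (k + 2)) (centre A 0) + radius B (k + 2) < radius B 0"
    and inner: "\<And>k. 0 < radius B (k + 2) \<Longrightarrow>
       radius B 1 + radius B (k + 2) < dist (centre B (k + 2)) (centre A 0)"
    and sep: "\<And>k l. k \<noteq> l \<Longrightarrow> 0 < radius B (k + 2) \<Longrightarrow> 0 < radius B (l + 2) \<Longrightarrow>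
       radius B (k + 2) + radius B (l + 2) < dist (centre B (k + 2)) (centre B (l + 2))"
    by metis
  note D = configsD[OF B]

  obtain \<sigma> :: "nat \<Rightarrow> nat" where "inj \<sigma>" and anti: "antimono ((\<lambda>n. radius B (n + 2)) \<circ> \<sigma>)"
    and range: "{n. 0 < radius B (n + 2)} \<subseteq> range \<sigma>"
    using ex_decreasing_rearrangement[OF D(5) summable_LIMSEQ_zero[OF D(7)]] by metis
  \<comment> \<open>The two annulus discs stay in place; only the discs from index 2 on are
    sorted.\<close>
  define C where "C n = (if n < 2 then B n else B (\<sigma> (n - 2) + 2))" for n
  have C01: "C 0 = B 0" "C 1 = B 1" and C2: "C (n + 2) = B (\<sigma> n + 2)" for n
    by (simp_all add: C_def)
  have cases2: thesis if "n \<ge> 1" "n = 1 \<Longrightarrow> thesis" "\<And>j. n = j + 2 \<Longrightarrow> thesis" for n :: nat and thesis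
    using that by (metis One_nat_def add_2_eq_Suc' not0_implies_Suc not_one_le_zero)
  have nonnegC: "0 \<le> radius C n" and normC: "norm (centre C n) \<le> M" for n
    using D(5,6) by (simp_all add: C_def)
  define S where "S = (\<Sum>n. radius C (n + 2))"
  have summC: "summable (\<lambda>n. radius C (n + 2))"
    using summable_reindex[OF D(7) \<open>inj \<sigma>\<close> D(5)] by (simp only: C2 comp_def)
  \<comment> \<open>An injective selection of nonnegative terms cannot raise the sum, and the gap
    condition for \<open>C\<close> needs no more than this.\<close>
  have "S \<le> (\<Sum>n. radius B (n + 2))"
    using suminf_reindex_mono[OF D(7) \<open>inj \<sigma>\<close> D(5)] by (simp only: S_def C2 comp_def)
  then have gap: "\<delta> + 2 * S \<le> radius C 0 - radius C 1"
    using D(8) unfolding C01 by linarith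
  have "0 \<le> S" unfolding S_def using nonnegC by (intro suminf_nonneg summC)
  have rhoC: "rho_ann C = ereal S" unfolding S_def by (rule rho_ann_eq_ereal[OF summC])
  have bounds: "radius C 0 \<le> radius A 0" "radius A 1 \<le> radius C 1"
    using D(3,4) unfolding C01 .
  have cenC: "centre C 0 = centre A 0" "centre C 1 = centre A 0"
    using D(1,2) unfolding C01 .
  have less: "radius C 1 < radius C 0" using gap \<open>0 \<le> S\<close> \<open>0 < \<delta>\<close> by linarith

  have swiss: "C \<in> swiss_cheeses" using nonnegC by (simp add: swiss_cheeses_def)
  have "annular C"
    using swiss cenC less bounds r1 by (simp add: annular_def)
  moreover have "classical C"
    unfolding classical_def
  proof (intro conjI ballI impI swiss)
    show "summable (\<lambda>n. radius C (n + 1))"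
      using summC summable_Suc_iff[of "\<lambda>n. radius C (n + 1)"] by simp
    show "0 < radius C 0" using less nonnegC[of 1] by linarith
    fix k assume k: "k \<in> positive_indices C"
    then have "k \<ge> 1" "0 < radius C k" by (auto simp: positive_indices_def)
    have "dist (centre C k) (centre C 0) + radius C k < radius C 0"
    proof (rule cases2[OF \<open>k \<ge> 1\<close>])
      assume "k = 1"
      then show ?thesis using less cenC by simp
    next
      fix j assume "k = j + 2"
      then show ?thesis using outer[of "\<sigma> j"] \<open>0 < radius C k\<close> unfolding cenC by (simp only: C01 C2)
    qed
    then show "cball (centre C k) (radius C k) \<subseteq> ball (centre C 0) (radius C 0)"
      by (simp add: cball_subset_ball_iff)
    fix l assume l: "l \<in> positive_indices C" and "l \<noteq> k"
    then have "l \<ge> 1" "0 < radius C l" by (auto simp: positive_indices_def)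
    have sep1: "radius C 1 + radius C (j + 2) < dist (centre C 1) (centre C (j + 2))"
      if "0 < radius C (j + 2)" for j
      using inner[of "\<sigma> j"] that unfolding cenC by (simp only: C01 C2 dist_commute)
    have "radius C k + radius C l < dist (centre C k) (centre C l)"
    proof (rule cases2[OF \<open>k \<ge> 1\<close>]; rule cases2[OF \<open>l \<ge> 1\<close>])
      assume "k = 1" "l = 1"
      then show ?thesis using \<open>l \<noteq> k\<close> by simp
    next
      fix j assume "k = 1" "l = j + 2"
      then show ?thesis using sep1[of j] \<open>0 < radius C l\<close> by simp
    next
      fix i assume "k = i + 2" "l = 1"
      then show ?thesis using sep1[of i] \<open>0 < radius C k\<close> by (simp add: dist_commute add.commute)
    next
      fix i j assume ij: "k = i + 2" "l = j + 2"
      then have "\<sigma> i \<noteq> \<sigma> j" using \<open>inj \<sigma>\<close> \<open>l \<noteq> k\<close> by (auto dest: injD)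
      then show ?thesis
        using sep \<open>0 < radius C k\<close> \<open>0 < radius C l\<close> unfolding ij C2 by blast
    qed
    then show "cball (centre C k) (radius C k) \<inter> cball (centre C l) (radius C l) = {}"
      by (rule disjoint_cballI)
  qed
  moreover have above: "partially_above C A"
    unfolding partially_above_def
  proof (intro conjI allI impI)
    show "cball (centre C 0) (radius C 0) \<subseteq> cball (centre A 0) (radius A 0)"
      using bounds cenC by (simp add: subset_cball)
    fix n :: nat assume "n \<ge> 1"
    show "ball (centre A n) (radius A n) \<subseteq> - cball (centre C 0) (radius C 0) \<or>
        (\<exists>m\<ge>1. ball (centre A n) (radius A n) \<subseteq> ball (centre C m) (radius C m))"
    proof (rule cases2[OF \<open>n \<ge> 1\<close>])
      assume "n = 1"
      then have "ball (centre A n) (radius A n) \<subseteq> ball (centre C 1) (radius C 1)"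
        using bounds cenC cen by (simp add: subset_ball)
      then show ?thesis by blast
    next
      fix j assume n: "n = j + 2"
      show ?thesis
      proof (cases "0 < radius A n")
        \<comment> \<open>Configurations cover only discs of positive radius; a disc of radius zero
          is empty.\<close>
        case False
        then have "ball (centre A n) (radius A n) = {}" by simp
        then show ?thesis by blast
      next
        case True
        then have pos: "0 < radius A (j + 2)" by (simp only: n)
        show ?thesis
          using D(9)[OF pos]
        proof (elim disjE exE conjE)
          assume *: "radius B 0 + radius A (j + 2) \<le> dist (centre A (j + 2)) (centre A 0)"
          \<comment> \<open>The disc is open, so its points lie strictly beyond the outer circle,
            even in the tangent case.\<close>
          have "x \<notin> cball (centre C 0) (radius C 0)" if "x \<in> ball (centre A n) (radius A n)" for x
            using that * dist_triangle[of "centre A n" "centre A 0" x]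
            unfolding n C01 D(1) mem_cball mem_ball by (simp add: dist_commute)
          then show ?thesis by blast
        next
          assume "dist (centre A (j + 2)) (centre A 0) + radius A (j + 2) \<le> radius B 1"
          then have "ball (centre A n) (radius A n) \<subseteq> ball (centre C 1) (radius C 1)"
            unfolding n C01 D(2) ball_subset_ball_iff by blast
          then show ?thesis by blast
        next
          fix m
          assume *: "dist (centre A (j + 2)) (centre B (m + 2)) + radius A (j + 2) \<le> radius B (m + 2)"
          \<comment> \<open>A disc that covers one of positive radius has positive radius itself, so
            the sorting did not drop it.\<close>
          then have "0 < radius B (m + 2)"
            using pos zero_le_dist[of "centre A (j + 2)" "centre B (m + 2)"] by linarith
          then obtain i where "m = \<sigma> i" using range by blast
          then have "ball (centre A n) (radius A n) \<subseteq> ball (centre C (i + 2)) (radius C (i + 2))"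
            using * unfolding n C2 ball_subset_ball_iff by blast
          moreover have "i + 2 \<ge> 1" by simp
          ultimately show ?thesis by blast
        qed
      qed
    qed
  qed
  moreover have "C \<in> annular_family A"
  proof -
    have "antimono_on {2..} (radius C)"
    proof (rule monotone_onI)
      fix x y :: nat assume "x \<in> {2..}" "y \<in> {2..}" "x \<le> y"
      then show "radius C y \<le> radius C x"
        using antimonoD[OF anti, of "x - 2" "y - 2"] by (simp add: C_def)
    qed
    \<comment> \<open>By the gap condition, \<open>\<delta> + 2 * S \<le> radius C 0 - radius C 1
      \<le> radius A 0 - radius A 1 = \<delta> + 2 * R\<close>.\<close>
    moreover have "rho_ann C \<le> rho_ann A"
      using gap bounds unfolding rhoA rhoC \<delta>_def by simp
    moreover have "mu C \<le> mu A"
      unfolding M unfolding mu_def using normC by (intro SUP_least) simp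
    ultimately show ?thesis
      unfolding annular_family_def using swiss above cenC bounds less by simp
  qed
  moreover have "delta_ann C \<ge> delta_ann A"
    using gap unfolding deltaA by (simp add: delta_ann_def rhoC)
  \<comment> \<open>The circles of \<open>C\<close> are at least \<open>\<delta>\<close> apart, and
    \<open>radius A 1 + \<delta> = radius A 0 - 2 * R\<close>. So a lower bound on the inner radius
    bounds the outer one from below, and an upper bound on the outer radius bounds the inner one
    from above.\<close>
  moreover have "ereal (radius A 0) - 2 * rho_ann A \<le> ereal (radius C 0)"
    "ereal (radius C 1) \<le> ereal (radius A 1) + 2 * rho_ann A"
    using gap bounds \<open>0 \<le> S\<close> by (simp_all add: rhoA \<delta>_def)
  ultimately show ?thesis
    using bounds partially_above_cheese_set[OF above] by blast
qed

end
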